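(* Let $0<q<1$, $M\in\mathbb N$, $\vec k=(k_1,\dots,k_M)$ with all $k_j>0$, and $\lambda,\rho\in\mathbb R$. (i) The measure $W_{\mathsf L}$ is reversible for $\mathrm{ASIP}_{\mathsf L}(q,\vec k,\lambda)$ on $X_d$ if $\lambda>-1$, and on $X_{d,\lambda}$ if $\lambda\le-1$. (ii) The measure $W_{\mathsf R}$ is reversible for $\mathrm{ASIP}_{\mathsf R}(q,\vec k,\rho)$ on $X_d$ if $\rho>-1$, and on $X_{d,\rho}$ if $\rho\le-1$.
   Context: Notation: $X_d=\mathbb Z_{\ge0}^M$; $|\eta|=\sum_j\eta_j$; $X_{d,a}=\{\eta\in X_d:2|\eta|+|\vec k|+a<0\}$; $[a]_q=\frac{q^a-q^{-a}}{q-q^{-1}}$; $(a;q)_n=\prod_{i=0}^{n-1}(1-aq^i)$, $(a;q)_\infty=\prod_{i\ge0}(1-aq^i)$. $\eta^{j,m}$ is $\eta$ with one particle moved from $j$ to $m$ if $\eta_j\ge1$, else $\eta$. A measure $\mu$ on a countable state space is reversible for a jump process with jump rates $L(\eta,\eta')$ if $\mu(\eta)L(\eta,\eta')=\mu(\eta')L(\eta',\eta)$ for all $\eta\ne\eta'$. Heights: $h^-_0=\lambda$, $h^-_j(\zeta)=\lambda+\sum_{i\le j}(2\zeta_i+k_i)$; $h^+_{M+1}=\rho$, $h^+_j(\xi)=\rho+\sum_{i\ge j}(2\xi_i+k_i)$. $\mathrm{ASIP}_{\mathsf L}(q,\vec k,\lambda)$: state space $X_d$ if $\lambda>-1$, $X_{d,\lambda}$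 if $\lambda\le-1$; from $\zeta$ it jumps to $\zeta^{j,j+1}$ ($1\le j\le M-1$) at rate $C_j^{\mathsf L,+}$ and to $\zeta^{j,j-1}$ ($2\le j\le M$) at rate $C_j^{\mathsf L,-}$, where $$C_j^{\mathsf L,+}=[\zeta_j]_q[\zeta_{j+1}+k_{j+1}]_q\frac{[h^-_{j-1}+\zeta_j]_q[h^-_j+\zeta_{j+1}]_q}{[h^-_j]_q[h^-_j-1]_q},\quad C_j^{\mathsf L,-}=[\zeta_j]_q[\zeta_{j-1}+k_{j-1}]_q\frac{[h^-_{j-1}-\zeta_{j-1}]_q[h^-_j-\zeta_j]_q}{[h^-_{j-1}]_q[h^-_{j-1}+1]_q}.$$ $\mathrm{ASIP}_{\mathsf R}(q,\vec k,\rho)$: state space $X_d$ if $\rho>-1$, $X_{d,\rho}$ if $\rho\le-1$; from $\xi$ it jumps to $\xi^{j,j+1}$ at rate $C_j^{\mathsf R,+}$ and to $\xi^{j,j-1}$ at rate $C_j^{\mathsf R,-}$, where $$C_j^{\mathsf R,+}=[\xi_j]_q[\xi_{j+1}+k_{j+1}]_q\frac{[h^+_j-\xi_j]_q[h^+_{j+1}-\xi_{j+1}]_q}{[h^+_{j+1}]_q[h^+_{j+1}+1]_q},\quad C_j^{\mathsf R,-}=[\xi_j]_q[\xi_{j-1}+k_{j-1}]_q\frac{[h^+_j+\xi_{j-1}]_q[h^+_{j+1}+\xi_j]_q}{[h^+_j]_q[h^+_j-1]_q}.$$ Conventions: a rate is $0$ when the departing site $j$ is empty; $[h^-_{j-1}-\zeta_{j-1}]_q/[h^-_{j-1}]_q$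 is read as $1$ when $\zeta_{j-1}=0$, and $[h^+_{j+1}-\xi_{j+1}]_q/[h^+_{j+1}]_q$ as $1$ when $\xi_{j+1}=0$. One-site weight, with case distinction on its argument $a$: $$w_{\mathsf{dyn}}(z;a,k,q)=\frac{1-q^{4z+2a+2k}}{1-q^{2z+2a+2k}}\frac{(q^{2k};q^2)_z}{(q^2;q^2)_z}\frac{(q^{2z+2a+2};q^2)_\infty}{(q^{2z+2a+2k+2};q^2)_\infty}q^{2z(z+a)}\quad\text{if }a>-1,$$ $$w_{\mathsf{dyn}}(z;a,k,q)=\frac{1-q^{4z+2a+2k}}{1-q^{2z+2a+2k}}\frac{(q^{2k};q^2)_z}{(q^2;q^2)_z}\frac{(q^{-2z-2a-2k};q^2)_\infty}{(q^{-2z-2a};q^2)_\infty}q^{-2z(z+a+k)}\quad\text{if }a\le-1,$$ where the first quotient is read as $1$ for $z=0$. The measures are $$W_{\mathsf L}(\zeta)=\prod_{j=1}^Mw_{\mathsf{dyn}}(\zeta_j;h^-_{j-1}(\zeta),k_j,q),\qquad W_{\mathsf R}(\xi)=\prod_{j=1}^Mw_{\mathsf{dyn}}(\xi_j;h^+_{j+1}(\xi),k_j,q).$$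
   Formalization: In W_L and W_R the form of the one-site weight is chosen by the boundary value (λ resp. ρ being > -1 or ≤ -1), the same at all sites, not by each site's argument a; with the choice by a the claim fails, e.g. M=2, q=0.7, k=(0.2,0.2), λ=-3. *)

theory Defs
  imports "HOL-Analysis.Analysis"
begin

definition q_number :: "real \<Rightarrow> real \<Rightarrow> real" where
  "q_number q a = (q powr a - q powr (- a)) / (q - inverse q)"

definition q_poch :: "real \<Rightarrow> real \<Rightarrow> nat \<Rightarrow> real" where
  "q_poch a q n = (\<Prod>i<n. 1 - a * q ^ i)"

definition q_poch_inf :: "real \<Rightarrow> real \<Rightarrow> real" where
  "q_poch_inf a q = (\<Prod>i. 1 - a * q ^ i)"

text \<open>A configuration in the \<open>M\<close>-fold power of the natural numbers is a function
  on the sites \<open>1, \<dots>, M\<close>, extended by \<open>0\<close> to all of \<open>nat\<close>. The parameters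
  \<open>k 1, \<dots>, k M\<close> are given by a function of which no other values are used.\<close>

definition configs :: "nat \<Rightarrow> (nat \<Rightarrow> nat) set" where
  "configs M = {\<eta>. \<forall>j. j \<notin> {1..M} \<longrightarrow> \<eta> j = 0}"

definition configs_below :: "nat \<Rightarrow> (nat \<Rightarrow> real) \<Rightarrow> real \<Rightarrow> (nat \<Rightarrow> nat) set" where
  "configs_below M k a =
     {\<eta> \<in> configs M. 2 * (\<Sum>j=1..M. real (\<eta> j)) + (\<Sum>j=1..M. k j) + a < 0}"

definition move :: "(nat \<Rightarrow> nat) \<Rightarrow> nat \<Rightarrow> nat \<Rightarrow> nat \<Rightarrow> nat" where
  "move \<eta> j m = (if \<eta> j \<ge> 1 then \<eta>(j := \<eta> j - 1, m := \<eta> m + 1) else \<eta>)"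

text \<open>\<open>\<mu>\<close> gives the point masses of a measure on \<open>S\<close>, hence the nonnegativity.\<close>

definition reversible :: "'s set \<Rightarrow> ('s \<Rightarrow> real) \<Rightarrow> ('s \<Rightarrow> 's \<Rightarrow> real) \<Rightarrow> bool" where
  "reversible S \<mu> L \<longleftrightarrow>
     (\<forall>\<eta>\<in>S. 0 \<le> \<mu> \<eta>) \<and>
     (\<forall>\<eta>\<in>S. \<forall>\<eta>'\<in>S. \<eta> \<noteq> \<eta>' \<longrightarrow> \<mu> \<eta> * L \<eta> \<eta>' = \<mu> \<eta>' * L \<eta>' \<eta>)"

definition height_minus :: "(nat \<Rightarrow> real) \<Rightarrow> real \<Rightarrow> (nat \<Rightarrow> nat) \<Rightarrow> nat \<Rightarrow> real" where
  "height_minus k lam \<zeta> j = lam + (\<Sum>i=1..j. 2 * real (\<zeta> i) + k i)"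

definition height_plus :: "nat \<Rightarrow> (nat \<Rightarrow> real) \<Rightarrow> real \<Rightarrow> (nat \<Rightarrow> nat) \<Rightarrow> nat \<Rightarrow> real" where
  "height_plus M k rho \<xi> j = rho + (\<Sum>i=j..M. 2 * real (\<xi> i) + k i)"

text \<open>In the four rates below, the case \<open>\<zeta> j = 0\<close> (\<open>\<xi> j = 0\<close>) is the convention that
  nothing leaves an empty site, and the inner conditional is the convention that
  \<open>[h - 0] / [h] = 1\<close> even if \<open>h = 0\<close>.\<close>

definition rate_L_right ::
    "(nat \<Rightarrow> real) \<Rightarrow> real \<Rightarrow> real \<Rightarrow> (nat \<Rightarrow> nat) \<Rightarrow> nat \<Rightarrow> real" where
  "rate_L_right k q lam \<zeta> j = (let h = height_minus k lam \<zeta> in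
     if \<zeta> j = 0 then 0 else
     q_number q (\<zeta> j) * q_number q (\<zeta> (j+1) + k (j+1)) *
     (q_number q (h (j-1) + \<zeta> j) * q_number q (h j + \<zeta> (j+1)) /
      (q_number q (h j) * q_number q (h j - 1))))"

definition rate_L_left ::
    "(nat \<Rightarrow> real) \<Rightarrow> real \<Rightarrow> real \<Rightarrow> (nat \<Rightarrow> nat) \<Rightarrow> nat \<Rightarrow> real" where
  "rate_L_left k q lam \<zeta> j = (let h = height_minus k lam \<zeta> in
     if \<zeta> j = 0 then 0 else
     q_number q (\<zeta> j) * q_number q (\<zeta> (j-1) + k (j-1)) *
     (if \<zeta> (j-1) = 0 then 1 else q_number q (h (j-1) - \<zeta> (j-1)) / q_number q (h (j-1))) *
     (q_number q (h j - \<zeta> j) / q_number q (h (j-1) + 1)))"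

definition rate_R_right ::
    "nat \<Rightarrow> (nat \<Rightarrow> real) \<Rightarrow> real \<Rightarrow> real \<Rightarrow> (nat \<Rightarrow> nat) \<Rightarrow> nat \<Rightarrow> real" where
  "rate_R_right M k q rho \<xi> j = (let h = height_plus M k rho \<xi> in
     if \<xi> j = 0 then 0 else
     q_number q (\<xi> j) * q_number q (\<xi> (j+1) + k (j+1)) *
     (if \<xi> (j+1) = 0 then 1 else q_number q (h (j+1) - \<xi> (j+1)) / q_number q (h (j+1))) *
     (q_number q (h j - \<xi> j) / q_number q (h (j+1) + 1)))"

definition rate_R_left ::
    "nat \<Rightarrow> (nat \<Rightarrow> real) \<Rightarrow> real \<Rightarrow> real \<Rightarrow> (nat \<Rightarrow> nat) \<Rightarrow> nat \<Rightarrow> real" where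
  "rate_R_left M k q rho \<xi> j = (let h = height_plus M k rho \<xi> in
     if \<xi> j = 0 then 0 else
     q_number q (\<xi> j) * q_number q (\<xi> (j-1) + k (j-1)) *
     (q_number q (h j + \<xi> (j-1)) * q_number q (h (j+1) + \<xi> j) /
      (q_number q (h j) * q_number q (h j - 1))))"

text \<open>The total rate from \<open>\<eta>\<close> to \<open>\<eta>'\<close> of the nearest-neighbour jumps on \<open>{1..M}\<close>.\<close>

definition jump_rate ::
    "nat \<Rightarrow> ((nat \<Rightarrow> nat) \<Rightarrow> nat \<Rightarrow> real) \<Rightarrow> ((nat \<Rightarrow> nat) \<Rightarrow> nat \<Rightarrow> real)
      \<Rightarrow> (nat \<Rightarrow> nat) \<Rightarrow> (nat \<Rightarrow> nat) \<Rightarrow> real" where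
  "jump_rate M right left \<eta> \<eta>' =
     (\<Sum>j=1..<M. if \<eta>' = move \<eta> j (j+1) then right \<eta> j else 0) +
     (\<Sum>j=2..M. if \<eta>' = move \<eta> j (j-1) then left \<eta> j else 0)"

definition ASIP_L :: "nat \<Rightarrow> (nat \<Rightarrow> real) \<Rightarrow> real \<Rightarrow> real
    \<Rightarrow> (nat \<Rightarrow> nat) \<Rightarrow> (nat \<Rightarrow> nat) \<Rightarrow> real" where
  "ASIP_L M k q lam = jump_rate M (rate_L_right k q lam) (rate_L_left k q lam)"

definition ASIP_R :: "nat \<Rightarrow> (nat \<Rightarrow> real) \<Rightarrow> real \<Rightarrow> real
    \<Rightarrow> (nat \<Rightarrow> nat) \<Rightarrow> (nat \<Rightarrow> nat) \<Rightarrow> real" where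
  "ASIP_R M k q rho = jump_rate M (rate_R_right M k q rho) (rate_R_left M k q rho)"

text \<open>The one-site weight has two forms. The extra argument \<open>b\<close> selects the form:
  \<open>b = a\<close> gives the weight with case distinction on its own argument \<open>a\<close>, whereas the
  measures \<open>W_L\<close> and \<open>W_R\<close> use the boundary value \<open>b = lam\<close> resp. \<open>b = rho\<close>, i.e. the
  same form at all sites.

  For boundary values \<open>> -1\<close> all heights are \<open>> -1\<close> and the choice makes no
  difference. For boundary values \<open>\<le> -1\<close> a height \<open>a\<close> in the interval \<open>(-1, 0)\<close> can occur
  (only in front of empty sites). There the case distinction on \<open>a\<close> would switch to the
  first form at some sites, depending on the configuration, and detailed balance fails: for
  \<open>M = 2\<close>, \<open>q = 7/10\<close>, \<open>k = (1/5, 1/5)\<close>, \<open>lam = -3\<close>, the two sides for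
  \<open>(1,0)\<close>, \<open>(0,1)\<close> are about 0.00197 and 0.00310. No case distinction on \<open>a\<close> alone helps,
  since heights in \<open>(-1, 0)\<close> need the first form if the boundary value is \<open>> -1\<close>.
  Away from such heights the two readings agree, see the lemmas at the end.\<close>

definition w_dyn :: "real \<Rightarrow> nat \<Rightarrow> real \<Rightarrow> real \<Rightarrow> real \<Rightarrow> real" where
  "w_dyn b z a k q =
     (if z = 0 then 1
      else (1 - q powr (4 * z + 2 * a + 2 * k)) / (1 - q powr (2 * z + 2 * a + 2 * k))) *
     (q_poch (q powr (2 * k)) (q\<^sup>2) z / q_poch (q\<^sup>2) (q\<^sup>2) z) *
     (if b > -1 then
        q_poch_inf (q powr (2 * z + 2 * a + 2)) (q\<^sup>2) /
        q_poch_inf (q powr (2 * z + 2 * a + 2 * k + 2)) (q\<^sup>2) *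
        q powr (2 * z * (z + a))
      else
        q_poch_inf (q powr (- 2 * z - 2 * a - 2 * k)) (q\<^sup>2) /
        q_poch_inf (q powr (- 2 * z - 2 * a)) (q\<^sup>2) *
        q powr (- 2 * z * (z + a + k)))"

definition W_L :: "nat \<Rightarrow> (nat \<Rightarrow> real) \<Rightarrow> real \<Rightarrow> real \<Rightarrow> (nat \<Rightarrow> nat) \<Rightarrow> real" where
  "W_L M k q lam \<zeta> =
     (\<Prod>j=1..M. w_dyn lam (\<zeta> j) (height_minus k lam \<zeta> (j-1)) (k j) q)"

definition W_R :: "nat \<Rightarrow> (nat \<Rightarrow> real) \<Rightarrow> real \<Rightarrow> real \<Rightarrow> (nat \<Rightarrow> nat) \<Rightarrow> real" where
  "W_R M k q rho \<xi> =
     (\<Prod>j=1..M. w_dyn rho (\<xi> j) (height_plus M k rho \<xi> (j+1)) (k j) q)"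

lemma w_dyn_cong: "(b > -1 \<longleftrightarrow> c > -1) \<Longrightarrow> w_dyn b z a k q = w_dyn c z a k q"
  unfolding w_dyn_def by simp

lemma W_L_case_on_height:
  assumes "\<forall>j\<in>{1..M}. 0 < k j"
    and "lam > -1 \<or> (lam \<le> -1 \<and> (\<forall>j\<in>{1..M}. height_minus k lam \<zeta> (j-1) \<le> -1))"
  shows "W_L M k q lam \<zeta> =
    (\<Prod>j=1..M. w_dyn (height_minus k lam \<zeta> (j-1)) (\<zeta> j) (height_minus k lam \<zeta> (j-1)) (k j) q)"
  unfolding W_L_def
proof (intro prod.cong refl w_dyn_cong)
  fix j assume j: "j \<in> {1..M}"
  have "0 \<le> (\<Sum>i=1..j-1. 2 * real (\<zeta> i) + k i)"
    using assms(1) j by (intro sum_nonneg add_nonneg_nonneg) (auto intro!: less_imp_le[of _ "k _"])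
  then show "lam > -1 \<longleftrightarrow> height_minus k lam \<zeta> (j-1) > -1"
    using assms(2) j unfolding height_minus_def by force
qed

lemma W_R_case_on_height:
  assumes "\<forall>j\<in>{1..M}. 0 < k j"
    and "rho > -1 \<or> (rho \<le> -1 \<and> (\<forall>j\<in>{1..M}. height_plus M k rho \<xi> (j+1) \<le> -1))"
  shows "W_R M k q rho \<xi> =
    (\<Prod>j=1..M. w_dyn (height_plus M k rho \<xi> (j+1)) (\<xi> j) (height_plus M k rho \<xi> (j+1)) (k j) q)"
  unfolding W_R_def
proof (intro prod.cong refl w_dyn_cong)
  fix j assume j: "j \<in> {1..M}"
  have "0 \<le> (\<Sum>i=j+1..M. 2 * real (\<xi> i) + k i)"
    using assms(1) j by (intro sum_nonneg add_nonneg_nonneg) (auto intro!: less_imp_le[of _ "k _"])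
  then show "rho > -1 \<longleftrightarrow> height_plus M k rho \<xi> (j+1) > -1"
    using assms(2) j unfolding height_plus_def by force
qed

end

theory Submission
  imports Defs
begin

text \<open>A jump across a bond changes only the height \<open>h\<close> between its two sites, by \<open>2\<close>, so detailed
  balance is an identity between the weights and rates of these two sites. It splits into two
  one-site recurrences for \<open>w_dyn\<close>: one for the site that determines \<open>h\<close> and loses a particle, one
  for the other site, which gains a particle while its argument drops from \<open>h\<close> to \<open>h - 2\<close>. Each
  holds up to a power of \<open>q\<close> depending only on \<open>h\<close>, and the two powers cancel. The right
  process is the mirror image of the left one and uses the same two-site identity.\<close>

section \<open>Building blocks of the q-numbers and of the one-site weight\<close>

definition q_compl :: "real \<Rightarrow> real \<Rightarrow> real" where
  "q_compl q x = 1 - q powr (2 * x)"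

definition q_tail :: "real \<Rightarrow> real \<Rightarrow> real" where
  "q_tail q x = q_poch_inf (q powr (2 * x)) (q\<^sup>2)"

text \<open>The only factor of \<open>w_dyn\<close> that depends on the selected form; the other two
  factors are common to both forms.\<close>

definition dyn_tail :: "real \<Rightarrow> real \<Rightarrow> nat \<Rightarrow> real \<Rightarrow> real \<Rightarrow> real" where
  "dyn_tail q b z a k =
     (if b > -1 then q_tail q (z + a + 1) / q_tail q (z + a + k + 1) * q powr (2 * z * (z + a))
      else q_tail q (- (z + a + k)) / q_tail q (- (z + a)) * q powr (- 2 * z * (z + a + k)))"

text \<open>What membership in the state space gives at one site. For \<open>b \<le> -1\<close> the height behind
  the site is negative, which keeps every q-number in a denominator away from \<open>0\<close>.\<close>

definition admissible :: "real \<Rightarrow> nat \<Rightarrow> real \<Rightarrow> real \<Rightarrow> bool" where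
  "admissible b z a k \<longleftrightarrow> 0 < k \<and> (if b > -1 then a > -1 else a + 2 * z + k < 0)"

text \<open>Field arithmetic of a tail recurrence in the first form: \<open>c1\<close>,
  \<open>c2\<close> are the factors split off the infinite products, \<open>I1\<close>,
  \<open>I2\<close> the remaining tails, \<open>p\<close> and \<open>p * r\<close> the powers of
  \<open>q\<close>.\<close>

lemma tail_step_up:
  fixes c1 c2 I1 I2 p r :: real
  assumes "c2 \<noteq> 0"
  shows "I1 / I2 * (p * r) * c1 = (c1 * I1) / (c2 * I2) * p * c2 * r"
  using assms by simp

text \<open>The same for the second form. The split-off factors are \<open>q_compl\<close> at
  negated arguments; by \<open>q_compl_minus\<close> their signs cancel in the quotient, and the
  first premise balances their powers.\<close>

lemma tail_step_down:
  fixes p1 p2 gu gv cu cv r I1 I2 :: real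
  assumes "p1 * gu = p2 * r * gv" "cv \<noteq> 0" "gv \<noteq> 0"
  shows "(- (gu * cu) * I1) / (- (gv * cv) * I2) * p1 * cv = I1 / I2 * p2 * cu * r"
proof -
  have "(- (gu * cu) * I1) / (- (gv * cv) * I2) * p1 * cv = (p1 * gu) * (cu * I1) / (gv * I2)"
    using assms(2) by simp
  also have "\<dots> = I1 / I2 * p2 * cu * r"
    unfolding assms(1) using assms(3) by simp
  finally show ?thesis .
qed

section \<open>q-numbers and infinite q-products for \<open>0 < q < 1\<close>\<close>

context
  fixes q :: real
  assumes q: "0 < q" "q < 1"
begin

lemma q_sq_less_1: "q\<^sup>2 < 1"
  using q by (simp add: power_less_one_iff)

lemma q_compl_pos: "x > 0 \<Longrightarrow> q_compl q x > 0"
  using q powr_less_mono2_neg[of "-(2*x)" q 1] by (simp add: q_compl_def powr01_less_one)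

lemma q_compl_minus: "q_compl q (- x) = - (q powr (- 2 * x) * q_compl q x)"
  using q by (simp add: q_compl_def algebra_simps flip: powr_add)

lemma q_compl_neg: "x < 0 \<Longrightarrow> q_compl q x < 0"
  using q_compl_pos[of "-x"] q_compl_minus[of x] q 
  by (simp add: mult_less_0_iff zero_less_mult_iff)

lemma q_compl_nonzero: "x \<noteq> 0 \<Longrightarrow> q_compl q x \<noteq> 0"
  using q_compl_pos[of x] q_compl_neg[of x] by linarith

text \<open>Separates a power of \<open>q\<close> from the factor that can vanish or be negative, so
  that a recurrence splits into matching \<open>q_compl\<close> factors and comparing
  exponents.\<close>

lemma q_number_eq: "q_number q x = q powr (- x) * q_compl q x / (1 / q - q)"
proof -
  have "q powr x = q powr (- x) * q powr (2 * x)"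
    by (simp flip: powr_add)
  then have "q powr x - q powr (- x) = - (q powr (- x) * q_compl q x)"
    by (simp add: q_compl_def right_diff_distrib)
  moreover have "q - inverse q = - (1 / q - q)"
    by (simp add: inverse_eq_divide)
  ultimately show ?thesis
    unfolding q_number_def by (simp only: minus_divide_divide)
qed

lemma q_number_denominator_nonzero: "1 / q - q \<noteq> 0"
proof -
  have "1 < 1 / q" using q by simp
  then show ?thesis using q by linarith
qed

lemma q_number_nonzero:
  assumes "x \<noteq> 0"
  shows "q_number q x \<noteq> 0"
  using q_compl_nonzero[OF assms] q_number_denominator_nonzero q by (simp add: q_number_eq)

text \<open>Since \<open>q powr (2 * x) < 1\<close>, the subtracted terms form a summable geometric
  sequence below 1, so no factor vanishes and the product converges.\<close>

lemma q_tail_factors: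
  assumes "x > 0"
  shows "convergent_prod (\<lambda>i. 1 - q powr (2 * x) * (q\<^sup>2) ^ i)"
    and "1 - q powr (2 * x) * (q\<^sup>2) ^ i > 0"
proof -
  have less1: "q powr (2 * x) < 1" using q_compl_pos[OF assms] by (simp add: q_compl_def)
  have lt: "q powr (2 * x) * (q\<^sup>2) ^ i < 1" for i
  proof -
    have "q powr (2 * x) * (q\<^sup>2) ^ i \<le> q powr (2 * x) * 1"
      using q by (intro mult_left_mono power_le_one) (auto intro: power_le_one)
    then show ?thesis using less1 by simp
  qed
  then show "1 - q powr (2 * x) * (q\<^sup>2) ^ i > 0" by simp
  have "summable (\<lambda>i. \<bar>- (q powr (2 * x) * (q\<^sup>2) ^ i)\<bar>)"
    using q q_sq_less_1 by (simp add: abs_mult summable_mult summable_geometric)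
  then have "convergent_prod (\<lambda>i. 1 + - (q powr (2 * x) * (q\<^sup>2) ^ i))"
    by (rule summable_imp_convergent_prod_real) (use lt in \<open>force simp: less_le\<close>)
  then show "convergent_prod (\<lambda>i. 1 - q powr (2 * x) * (q\<^sup>2) ^ i)" by simp
qed

lemma q_tail_pos: "x > 0 \<Longrightarrow> q_tail q x > 0"
  unfolding q_tail_def q_poch_inf_def
  by (intro less_0_prodinf q_tail_factors)

lemma q_tail_step:
  assumes "x > 0"
  shows "q_tail q x = q_compl q x * q_tail q (x + 1)"
proof -
  \<comment> \<open>Raising the argument by 1 shifts the index of the product by one.\<close>
  have eq: "q powr (2 * (x + 1)) * (q\<^sup>2) ^ i = q powr (2 * x) * (q\<^sup>2) ^ Suc i" for i
    using q by (simp add: powr_add distrib_left)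
  have "q_tail q (x + 1) = q_tail q x / q_compl q x"
    unfolding q_tail_def q_poch_inf_def q_compl_def eq
    using prodinf_split_head[OF q_tail_factors(1)[OF assms]] q_tail_factors(2)[OF assms, of 0] by simp
  then show ?thesis using q_compl_pos[OF assms] by simp
qed

section \<open>The one-site weight: factorization and sign\<close>

lemma w_dyn_eq:
  "w_dyn b z a k q =
     (if z = 0 then 1 else q_compl q (2 * real z + a + k) / q_compl q (real z + a + k)) *
     (q_poch (q powr (2 * k)) (q\<^sup>2) z / q_poch (q\<^sup>2) (q\<^sup>2) z) * dyn_tail q b z a k"
proof -
  have "real (2 * z) + 2 * a + 2 * k + 2 = 2 * (real z + a + k + 1)"
    "real (4 * z) + 2 * a + 2 * k = 2 * (2 * real z + a + k)"
    "real (2 * z) + 2 * a + 2 * k = 2 * (real z + a + k)"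
    "real (2 * z) + 2 * a + 2 = 2 * (real z + a + 1)"
    "- 2 * real z - 2 * a - 2 * k = 2 * - (real z + a + k)"
    "- 2 * real z - 2 * a = 2 * - (real z + a)"
    "real (2 * z) * (real z + a) = 2 * real z * (real z + a)"
    by simp_all
  note exponents = this
  \<comment> \<open>The exponents in equations 1 and 5 contain those in 3 and 6 as subterms, so they
    are rewritten first.\<close>
  show ?thesis
    unfolding w_dyn_def exponents(1,5) unfolding exponents q_compl_def dyn_tail_def q_tail_def by simp
qed

lemma q_poch_ratio_Suc:
  "q_poch (q powr (2 * k)) (q\<^sup>2) (Suc z) / q_poch (q\<^sup>2) (q\<^sup>2) (Suc z) =
   q_poch (q powr (2 * k)) (q\<^sup>2) z / q_poch (q\<^sup>2) (q\<^sup>2) z * (q_compl q (k + real z) / q_compl q (real z + 1))"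
proof -
  have sq: "(q\<^sup>2) ^ n = q powr (2 * real n)" for n
    using powr_realpow[OF q(1), of "2 * n"] by (simp add: power_mult)
  have "q\<^sup>2 * (q\<^sup>2) ^ z = q powr (2 * (real z + 1))"
    using sq[of "Suc z"] by (simp add: add.commute)
  moreover have "q powr (2 * k) * (q\<^sup>2) ^ z = q powr (2 * (k + real z))"
    by (simp add: sq distrib_left powr_add)
  ultimately show ?thesis unfolding q_poch_def q_compl_def by simp
qed

lemma q_poch_ratio_pos:
  assumes "k > 0"
  shows "q_poch (q powr (2 * k)) (q\<^sup>2) z / q_poch (q\<^sup>2) (q\<^sup>2) z > 0"
proof (induction z)
  case 0 show ?case by (simp add: q_poch_def)
next
  case (Suc z)
  then show ?case unfolding q_poch_ratio_Suc
    using assms by (intro mult_pos_pos[OF Suc.IH] divide_pos_pos q_compl_pos) auto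
qed

lemma dyn_tail_pos:
  assumes "admissible b z a k"
  shows "dyn_tail q b z a k > 0"
  using assms q unfolding dyn_tail_def admissible_def
  by (auto split: if_splits intro!: mult_pos_pos divide_pos_pos q_tail_pos)

text \<open>For \<open>z \<ge> 1\<close> both arguments in the first quotient have the same sign:
  positive in the first form, negative in the second. The other two factors are positive.\<close>

lemma w_dyn_nonneg:
  assumes "admissible b z a k"
  shows "w_dyn b z a k q \<ge> 0"
proof -
  have "0 \<le> q_compl q (2 * real z + a + k) / q_compl q (real z + a + k)" if "z \<noteq> 0"
  proof (cases "b > -1")
    case True
    then show ?thesis using assms that unfolding admissible_def
      by (intro divide_nonneg_pos less_imp_le[OF q_compl_pos] q_compl_pos) auto
  next
    case False
    then show ?thesis using assms that unfolding admissible_def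
      by (intro divide_nonpos_neg less_imp_le[OF q_compl_neg] q_compl_neg) auto
  qed
  moreover have "k > 0" using assms by (simp add: admissible_def)
  ultimately show ?thesis
    unfolding w_dyn_eq 
    using q_poch_ratio_pos[of k z] dyn_tail_pos[OF assms]
    by (intro mult_nonneg_nonneg) auto
qed

section \<open>Recurrences of the weight and balance across one bond\<close>

text \<open>Adding a particle raises \<open>z + a\<close> and \<open>z + a + k\<close> by 1, so each
  infinite product changes by exactly one factor.\<close>

lemma dyn_tail_Suc:
  assumes "admissible b (Suc m) a k"
  shows "dyn_tail q b (Suc m) a k * q_compl q (real m + a + 1) =
    dyn_tail q b m a k * q_compl q (real m + a + k + 1) *
    q powr (if b > -1 then 2 * (2 * real m + 1 + a) else - 2 * (2 * real m + 1 + a + 2 * k))"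
proof (cases "b > -1")
  case True
  then have k: "a > -1" "k > 0" using assms by (auto simp: admissible_def)
  then have pos: "real m + a + 1 > 0" "real m + a + k + 1 > 0" by linarith+
  have pw: "q powr (2 * (real m + 1) * (real m + a + 1)) =
      q powr (2 * real m * (real m + a)) * q powr (2 * (2 * real m + 1 + a))"
    by (simp add: algebra_simps flip: powr_add)
  have ar: "real (Suc m) + a = real m + a + 1" "real (Suc m) = real m + 1" by auto
  have ar': "real m + a + 1 + k + 1 = real m + a + k + 1 + 1" by simp
  show ?thesis
    unfolding dyn_tail_def if_P[OF True] ar(1)
    unfolding ar(2) ar' pw q_tail_step[OF pos(1)] q_tail_step[OF pos(2)]
    by (rule tail_step_up) (use q_compl_pos[OF pos(2)] in simp)
next
  case False
  then have k: "a + 2 * real m + 2 + k < 0" "k > 0" using assms by (auto simp: admissible_def)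
  then have pos: "- (real m + a + k + 1) > 0" "- (real m + a + 1) > 0" by linarith+
  have pw: "q powr (- 2 * (real m + 1) * (real m + a + k + 1)) * q powr (- 2 * (real m + a + k + 1)) =
     q powr (- 2 * real m * (real m + a + k)) * q powr (- 2 * (2 * real m + 1 + a + 2 * k)) *
     q powr (- 2 * (real m + a + 1))"
    by (simp add: algebra_simps flip: powr_add)
  have ar: "real (Suc m) + a = real m + a + 1" "real m + a + 1 + k = real m + a + k + 1"
     "- (real m + a + k) = - (real m + a + k + 1) + 1" "- (real m + a) = - (real m + a + 1) + 1"
     "real (Suc m) = real m + 1" by auto
  show ?thesis
    unfolding dyn_tail_def if_not_P[OF False] ar(1)
    unfolding ar(2-) q_tail_step[OF pos(1)] q_tail_step[OF pos(2)] q_compl_minus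
    by (rule tail_step_down[OF pw]) (use q q_compl_neg[of "real m + a + 1"] pos in auto)
qed

text \<open>When a particle is added and the argument falls by 2, \<open>z + a\<close> falls by 1.
  Each infinite product again changes by one factor, now in the opposite direction.\<close>

lemma dyn_tail_shift:
  assumes "admissible b (Suc z) (a - 2) k"
  shows "dyn_tail q b z a k * q_compl q (real z + a) =
    dyn_tail q b (Suc z) (a - 2) k * q_compl q (real z + a + k) *
    q powr (if b > -1 then 2 - 2 * a else 2 * a - 2)"
proof (cases "b > -1")
  case True
  then have k: "a > 1" "k > 0" using assms by (auto simp: admissible_def)
  then have pos: "real z + a > 0" "real z + a + k > 0" by linarith+
  have pw: "q powr (2 * real z * (real z + a)) =
      q powr (2 * (real z + 1) * (real z + a - 1)) * q powr (2 - 2 * a)"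
    by (simp add: algebra_simps flip: powr_add)
  have ar: "real (Suc z) + (a - 2) + 1 = real z + a"
     "real (Suc z) + (a - 2) + k + 1 = real z + a + k"
     "real (Suc z) + (a - 2) = real z + a - 1" "real (Suc z) = real z + 1" by auto
  show ?thesis
    unfolding dyn_tail_def if_P[OF True] ar(1,2)
    unfolding ar(3) unfolding ar(4) pw q_tail_step[OF pos(1)] q_tail_step[OF pos(2)]
    by (rule tail_step_up) (use q_compl_pos[OF pos(2)] in simp)
next
  case False
  then have k: "a + 2 * real z + k < 0" "k > 0" using assms by (auto simp: admissible_def)
  then have pos: "- (real z + a + k) > 0" "- (real z + a) > 0" by linarith+
  have pw: "q powr (- 2 * real z * (real z + a + k)) * q powr (- 2 * (real z + a + k)) =
     q powr (- 2 * (real z + 1) * (real z + a + k - 1)) * q powr (2 * a - 2) * q powr (- 2 * (real z + a))"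
    by (simp add: algebra_simps flip: powr_add)
  have ar: "- (real (Suc z) + (a - 2)) = - (real z + a) + 1"
     "- (real (Suc z) + (a - 2) + k) = - (real z + a + k) + 1"
     "real (Suc z) + (a - 2) + k = real z + a + k - 1" "real (Suc z) = real z + 1" by auto
  show ?thesis
    unfolding dyn_tail_def if_not_P[OF False] ar(1,2)
    unfolding ar(3) unfolding ar(4) q_tail_step[OF pos(1)] q_tail_step[OF pos(2)] q_compl_minus
    by (rule tail_step_down[OF pw]) (use q q_compl_neg[of "real z + a"] pos in auto)
qed

text \<open>\<open>h\<close> is the height behind the site while it holds \<open>m + 1\<close>
  particles, \<open>h - 2\<close> the height once one has left. The conditional is a factor of the
  rate of the reverse jump.\<close>

lemma w_dyn_Suc:
  fixes a b k :: real and m :: nat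
  defines "h \<equiv> a + 2 * (real m + 1) + k"
  assumes adm: "admissible b (Suc m) a k"
  shows "w_dyn b (Suc m) a k q * (q_number q (real m + 1) * q_number q (a + (real m + 1))) =
    w_dyn b m a k q *
      (q_number q h * q_number q (real m + k) *
       (if m = 0 then 1 else q_number q (h - 2 - m) / q_number q (h - 2))) *
      q powr (if b > -1 then 2 * h - 2 else 2 - 2 * h)"
proof -
  define c where "c = 1 / q - q"
  define P where "P = q_poch (q powr (2 * k)) (q\<^sup>2) m / q_poch (q\<^sup>2) (q\<^sup>2) m"
  define Q where "Q = (if m = 0 then 1 else q_compl q (h - 2) / q_compl q (real m + a + k))"
  define cond where "cond = (if m = 0 then 1 else q_number q (h - 2 - m) / q_number q (h - 2))"
  define r where "r = q powr (if b > -1 then 2 * (2 * real m + 1 + a) else - 2 * (2 * real m + 1 + a + 2 * k))"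
  define s where "s = q powr (if b > -1 then 2 * h - 2 else 2 - 2 * h)"
  note c0 = q_number_denominator_nonzero[folded c_def]
  \<comment> \<open>For \<open>m = 0\<close> the value \<open>h - 2 = a + k\<close> can be
    zero.\<close>
  have "h - 2 \<noteq> 0 \<and> real m + a + k \<noteq> 0" if "m \<noteq> 0"
    using adm that by (cases "b > -1") (auto simp: admissible_def h_def)
  \<comment> \<open>Two conventions meet here: for \<open>m = 0\<close> the first quotient of the
    weight and the rate factor are both 1. Otherwise the \<open>q_compl\<close> terms cancel because
    \<open>h - 2 - m = m + a + k\<close>.\<close>
  then have Qc: "Q * cond = q powr m"
    using q c0 q_compl_nonzero[of "h - 2"] q_compl_nonzero[of "real m + a + k"]
    by (auto simp: Q_def cond_def q_number_eq h_def algebra_simps simp flip: powr_add powr_diff c_def)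
  have nz: "real m + a + k + 1 \<noteq> 0"
    using adm by (cases "b > -1") (auto simp: admissible_def)
  have ar: "2 * real (Suc m) + a + k = h" "real (Suc m) + a + k = real m + a + k + 1"
    by (simp_all add: h_def)
  have w': "w_dyn b (Suc m) a k q = q_compl q h / q_compl q (real m + a + k + 1) *
    (P * (q_compl q (k + real m) / q_compl q (real m + 1))) * dyn_tail q b (Suc m) a k"
    unfolding w_dyn_eq q_poch_ratio_Suc P_def ar by simp
  have w: "w_dyn b m a k q = Q * P * dyn_tail q b m a k"
    unfolding w_dyn_eq P_def Q_def h_def by (simp add: algebra_simps)
  have ar2: "real m + k = k + real m" "a + (real m + 1) = real m + a + 1"
    by simp_all
  have pw: "r * (q powr - (real m + 1) * q powr - (real m + a + 1)) =
    q powr - h * q powr - (k + real m) * q powr m * s"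
    unfolding r_def s_def h_def by (simp add: algebra_simps flip: powr_add)
  \<comment> \<open>The recurrence with \<open>q_compl\<close> factors and powers of
    \<open>q\<close> replaced by variables; the tail recurrence and the comparison of exponents
    enter as premises.\<close>
  have alg: "D / u * (P * (Dk / D1)) * T' * (g1 * D1 / c * (g2 * v / c)) =
       Q * P * T * (g3 * D / c * (g4 * Dk / c) * cond) * s"
    if "T' * v = T * u * r" "r * (g1 * g2) = g3 * g4 * q powr m * s" "u \<noteq> 0" "D1 \<noteq> 0"
    for D u T T' g1 g2 g3 g4 Dk D1 v :: real
  proof -
    have "D / u * (P * (Dk / D1)) * T' * (g1 * D1 / c * (g2 * v / c)) =
        D / u * P * Dk * (T' * v) * (g1 * g2) / (c * c)"
      using that(4) by simp
    also have "\<dots> = D * P * Dk * T * (r * (g1 * g2)) / (c * c)"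
      unfolding that(1) using that(3) by simp
    also have "\<dots> = Q * P * T * (g3 * D / c * (g4 * Dk / c) * cond) * s"
      unfolding that(2) Qc[symmetric] by simp
    finally show ?thesis .
  qed
  show ?thesis
    unfolding w w' ar2 cond_def[symmetric] s_def[symmetric] q_number_eq[of h] q_number_eq[of "k + real m"]
      q_number_eq[of "real m + 1"] q_number_eq[of "real m + a + 1"] c_def[symmetric]
    by (rule alg[OF dyn_tail_Suc[OF adm, folded r_def] pw])
      (use q_compl_nonzero[OF nz] q_compl_pos[of "real m + 1"] in auto)
qed

text \<open>The shift leaves \<open>2 * z + a + k\<close> and hence the numerator of the first
  quotient unchanged, and the q-numbers on both sides carry the same total power of
  \<open>q\<close>. The remaining power is that of the tails.\<close>

lemma w_dyn_shift:
  fixes a b k :: real and z :: nat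
  assumes adm: "admissible b (Suc z) (a - 2) k"
  shows "w_dyn b z a k q * (q_number q (real z + k) * q_number q (a + real z)) =
    w_dyn b (Suc z) (a - 2) k q * (q_number q (real z + 1) * q_number q (a + k + real z - 1)) *
    q powr (if b > -1 then 2 - 2 * a else 2 * a - 2)"
proof -
  define c where "c = 1 / q - q"
  define P where "P = q_poch (q powr (2 * k)) (q\<^sup>2) z / q_poch (q\<^sup>2) (q\<^sup>2) z"
  define r where "r = q powr (if b > -1 then 2 - 2 * a else 2 * a - 2)"
  note c0 = q_number_denominator_nonzero[folded c_def]
  have nz: "2 * real z + a + k \<noteq> 0" "real z + a + k \<noteq> 0" "real z + a + k - 1 \<noteq> 0" "real z + a \<noteq> 0"
    using adm by (cases "b > -1"; auto simp: admissible_def)+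
  note nz' = nz[THEN q_compl_nonzero]
  \<comment> \<open>Admissibility makes the denominator nonzero, so at \<open>z = 0\<close> the
    quotient is 1, in accordance with the convention.\<close>
  have Q: "(if z = 0 then 1 else q_compl q (2 * real z + a + k) / q_compl q (real z + a + k)) =
    q_compl q (2 * real z + a + k) / q_compl q (real z + a + k)"
    using nz'(2) by (cases "z = 0") simp_all
  have w: "w_dyn b z a k q = q_compl q (2 * real z + a + k) / q_compl q (real z + a + k) * P * dyn_tail q b z a k"
    unfolding w_dyn_eq Q P_def ..
  have ar: "2 * real (Suc z) + (a - 2) + k = 2 * real z + a + k"
    "real (Suc z) + (a - 2) + k = real z + a + k - 1" by simp_all
  have w': "w_dyn b (Suc z) (a - 2) k q = q_compl q (2 * real z + a + k) / q_compl q (real z + a + k - 1) *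
    (P * (q_compl q (k + real z) / q_compl q (real z + 1))) * dyn_tail q b (Suc z) (a - 2) k"
    unfolding w_dyn_eq q_poch_ratio_Suc P_def ar by simp
  have ar2: "real z + k = k + real z" "a + real z = real z + a" "a + k + real z - 1 = real z + a + k - 1"
    by simp_all
  have pw: "q powr - (k + real z) * q powr - (real z + a) = 
    q powr - (real z + 1) * q powr - (real z + a + k - 1)"
    by (simp add: algebra_simps flip: powr_add)
  have alg: "D / u * P * T * (g1 * Dk / c * (g2 * v / c)) =
       D / u1 * (P * (Dk / D1)) * T' * (g3 * D1 / c * (g4 * u1 / c)) * r"
    if "T * v = T' * u * r" "g1 * g2 = g3 * g4" "u \<noteq> 0" "u1 \<noteq> 0" "D1 \<noteq> 0"
    for D u u1 T T' g1 g2 g3 g4 Dk D1 v :: real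
  proof -
    have "D / u * P * T * (g1 * Dk / c * (g2 * v / c)) = D / u * P * (g1 * g2) * Dk * (T * v) / (c * c)"
      by simp
    also have "\<dots> = D / u1 * (P * (Dk / D1)) * T' * (g3 * D1 / c * (g4 * u1 / c)) * r"
      unfolding that(1,2) using that(3-) by simp
    finally show ?thesis .
  qed
  show ?thesis
    unfolding w w' ar2 q_number_eq c_def[symmetric] r_def[symmetric]
    by (rule alg[OF dyn_tail_shift[OF adm, folded r_def] pw]) (use nz' q_compl_pos[of "real z + 1"] in auto)
qed

text \<open>The first site, with argument \<open>a\<close>, passes a particle to the second, whose
  argument falls from \<open>h\<close> to \<open>h - 2\<close>. Each side is weight times rate,
  before the move on the left and after it on the right.\<close>

lemma two_site_balance:
  fixes a b k1 k2 :: real and m z :: nat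
  defines "h \<equiv> a + 2 * (real m + 1) + k1"
  assumes adm1: "admissible b (Suc m) a k1" and adm2: "admissible b (Suc z) (h - 2) k2"
  shows "w_dyn b (Suc m) a k1 q * w_dyn b z h k2 q *
      (q_number q (real m + 1) * q_number q (real z + k2) *
       (q_number q (a + (real m + 1)) * q_number q (h + real z) / (q_number q h * q_number q (h - 1)))) =
    w_dyn b m a k1 q * w_dyn b (Suc z) (h - 2) k2 q *
      (q_number q (real z + 1) * q_number q (real m + k1) *
       (if m = 0 then 1 else q_number q (h - 2 - real m) / q_number q (h - 2)) *
       (q_number q (h + k2 + real z - 1) / q_number q (h - 1)))"
    (is "?w1 * ?w2 * (?n1 * ?n2 * (?n3 * ?n4 / (?n5 * ?n6))) = ?w3 * ?w4 * (?n7 * ?n8 * ?cond * (?n9 / ?n6))")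
proof -
  \<comment> \<open>Allows cancelling \<open>[h]\<close>, which \<open>w_dyn_Suc\<close> puts into
    the numerator and the rate into the denominator.\<close>
  have "h \<noteq> 0"
    using adm1 by (cases "b > -1") (auto simp: admissible_def h_def)
  then have nz: "?n5 \<noteq> 0" by (rule q_number_nonzero)
  let ?s = "q powr (if b > -1 then 2 * h - 2 else 2 - 2 * h)"
  let ?t = "q powr (if b > -1 then 2 - 2 * h else 2 * h - 2)"
  have st: "?s * ?t = 1" using q by (simp flip: powr_add)
  have "?w1 * ?w2 * (?n1 * ?n2 * (?n3 * ?n4 / (?n5 * ?n6))) =
      (?w1 * (?n1 * ?n3)) * (?w2 * (?n2 * ?n4)) / (?n5 * ?n6)"
    by simp
  also have "\<dots> = (?w3 * (?n5 * ?n8 * ?cond) * ?s) * (?w4 * (?n7 * ?n9) * ?t) / (?n5 * ?n6)"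
    by (simp only: w_dyn_Suc[OF adm1, folded h_def] w_dyn_shift[OF adm2])
  also have "\<dots> = ?w3 * (?n8 * ?cond) * (?w4 * (?n7 * ?n9)) * (?s * ?t) / ?n6"
    using nz by simp
  also have "\<dots> = ?w3 * ?w4 * (?n7 * ?n8 * ?cond * (?n9 / ?n6))"
    unfolding st by simp
  finally show ?thesis .
qed

end

section \<open>From balance across bonds to reversibility\<close>

lemma move_move_back:
  assumes "move \<eta> j l \<noteq> \<eta>" "j \<noteq> l"
  shows "move (move \<eta> j l) l j = \<eta>"
proof -
  have "\<eta> j \<ge> 1"
    using assms(1) by (auto simp: move_def)
  then show ?thesis
    using assms(2) by (simp add: move_def fun_upd_twist)
qed

text \<open>Distinctness excludes a jump from an empty site, where \<open>move\<close> is the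
  identity but the reverse move need not be.\<close>

lemma move_eq_iff:
  assumes "\<eta> \<noteq> \<eta>'" "j \<noteq> l"
  shows "\<eta>' = move \<eta> j l \<longleftrightarrow> \<eta> = move \<eta>' l j"
  using move_move_back[of \<eta> j l] move_move_back[of \<eta>' l j] assms by metis

text \<open>A right jump from \<open>j\<close> is balanced by the left jump from
  \<open>Suc j\<close>, bond by bond. Writing \<open>\<eta> j = Suc n\<close> in the premise avoids
  truncated subtraction.\<close>

lemma reversible_jump_rateI:
  assumes nonneg: "\<And>\<eta>. \<eta> \<in> S \<Longrightarrow> 0 \<le> \<mu> \<eta>"
    and balance: "\<And>\<eta> j n. \<eta> \<in> S \<Longrightarrow> 1 \<le> j \<Longrightarrow> j < M \<Longrightarrow> \<eta> j = Suc n \<Longrightarrow>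
      \<eta>(j := n, Suc j := Suc (\<eta> (Suc j))) \<in> S \<Longrightarrow>
      \<mu> \<eta> * right \<eta> j = \<mu> (\<eta>(j := n, Suc j := Suc (\<eta> (Suc j)))) *
        left (\<eta>(j := n, Suc j := Suc (\<eta> (Suc j)))) (Suc j)"
  shows "reversible S \<mu> (jump_rate M right left)"
proof -
  define R where "R \<eta> \<eta>' = (\<Sum>j=1..<M. if \<eta>' = move \<eta> j (j+1) then right \<eta> j else 0)" for \<eta> \<eta>'
  define L where "L \<eta> \<eta>' = (\<Sum>j=2..M. if \<eta>' = move \<eta> j (j-1) then left \<eta> j else 0)" for \<eta> \<eta>'
  have RL: "\<mu> \<eta> * R \<eta> \<eta>' = \<mu> \<eta>' * L \<eta>' \<eta>" if S: "\<eta> \<in> S" "\<eta>' \<in> S" and ne: "\<eta> \<noteq> \<eta>'" for \<eta> \<eta>'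
  proof -
    \<comment> \<open>Left jumps are reindexed by their bond, so that both sums can be compared term
      by term.\<close>
    have "L \<eta>' \<eta> = (\<Sum>j=1..<M. if \<eta> = move \<eta>' (Suc j) j then left \<eta>' (Suc j) else 0)"
      unfolding L_def
      by (rule sum.reindex_bij_witness[of _ Suc "\<lambda>j. j - 1"]) auto
    also have "\<mu> \<eta>' * \<dots> = \<mu> \<eta> * R \<eta> \<eta>'"
      unfolding R_def sum_distrib_left
    proof (rule sum.cong[OF refl])
      fix j assume j: "j \<in> {1..<M}"
      show "\<mu> \<eta>' * (if \<eta> = move \<eta>' (Suc j) j then left \<eta>' (Suc j) else 0) =
        \<mu> \<eta> * (if \<eta>' = move \<eta> j (j + 1) then right \<eta> j else 0)"
      proof (cases "\<eta>' = move \<eta> j (j + 1)")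
        case True
        then obtain n where n: "\<eta> j = Suc n"
          using ne by (cases "\<eta> j") (auto simp: move_def)
        with True have "\<eta>' = \<eta>(j := n, Suc j := Suc (\<eta> (Suc j)))"
          by (simp add: move_def)
        then show ?thesis
          using True balance[OF S(1) _ _ n] S j move_eq_iff[OF ne, of j "Suc j"] by simp
      qed (use move_eq_iff[OF ne, of j "Suc j"] in simp)
    qed
    finally show ?thesis ..
  qed
  \<comment> \<open>\<open>RL\<close> in both orders pairs the right jumps of either state with the
    left jumps of the other.\<close>
  have "\<mu> \<eta> * (R \<eta> \<eta>' + L \<eta> \<eta>') = \<mu> \<eta>' * (R \<eta>' \<eta> + L \<eta>' \<eta>)"
    if "\<eta> \<in> S" "\<eta>' \<in> S" "\<eta> \<noteq> \<eta>'" for \<eta> \<eta>'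
    using RL[of \<eta> \<eta>'] RL[of \<eta>' \<eta>] that by (simp add: distrib_left)
  then show ?thesis
    using nonneg unfolding reversible_def jump_rate_def R_def L_def by blast
qed

text \<open>\<open>x\<close> and \<open>y\<close> stand for the two rates; the factors at all other
  sites form a common product.\<close>

lemma prod_two_sites:
  fixes f g :: "nat \<Rightarrow> real"
  assumes "1 \<le> j" "j < M"
    and "\<And>i. i \<in> {1..M} \<Longrightarrow> i \<noteq> j \<Longrightarrow> i \<noteq> Suc j \<Longrightarrow> f i = g i"
    and "f j * f (Suc j) * x = g j * g (Suc j) * y"
  shows "prod f {1..M} * x = prod g {1..M} * y"
proof -
  let ?A = "{1..M} - {j} - {Suc j}"
  have split: "prod u {1..M} = u j * u (Suc j) * prod u ?A" for u :: "nat \<Rightarrow> real"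
    using assms(1,2) prod.remove[of "{1..M}" j u] prod.remove[of "{1..M} - {j}" "Suc j" u]
    by (simp add: mult.assoc)
  have "prod f ?A = prod g ?A"
    using assms(3) by (intro prod.cong) auto
  then have "prod f {1..M} * x = f j * f (Suc j) * x * prod g ?A"
    by (simp only: split mult_ac)
  then show ?thesis
    unfolding assms(4) by (simp only: split mult_ac)
qed

section \<open>Heights along the sites and under a jump\<close>

lemma height_minus_0: "height_minus k lam \<zeta> 0 = lam"
  by (simp add: height_minus_def)

lemma height_minus_Suc:
  "height_minus k lam \<zeta> (Suc j) = height_minus k lam \<zeta> j + 2 * real (\<zeta> (Suc j)) + k (Suc j)"
  by (simp add: height_minus_def)

text \<open>Partial sums that contain both or neither of the two sites keep their value; only the
  one ending at \<open>j\<close> loses the particle.\<close>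

lemma height_minus_move:
  assumes "1 \<le> j" "\<zeta> j = Suc n"
  shows "height_minus k lam (\<zeta>(j := n, Suc j := Suc (\<zeta> (Suc j)))) i =
    height_minus k lam \<zeta> i - (if i = j then 2 else 0)"
  by (induction i) (use assms in \<open>auto simp: height_minus_0 height_minus_Suc\<close>)

lemma height_minus_mono:
  assumes "\<forall>j\<in>{1..M}. 0 < k j" "i \<le> j" "j \<le> M"
  shows "height_minus k lam \<zeta> i \<le> height_minus k lam \<zeta> j"
  using assms(2,3)
proof (induction j rule: dec_induct)
  case (step n)
  then show ?case using bspec[OF assms(1), of "Suc n"] by (simp add: height_minus_Suc)
qed simp

lemma height_plus_Suc:
  assumes "j \<le> M"
  shows "height_plus M k rho \<xi> j = height_plus M k rho \<xi> (Suc j) + 2 * real (\<xi> j) + k j"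
  using assms by (simp add: height_plus_def sum.atLeast_Suc_atMost)

text \<open>Here only the sum starting at \<open>Suc j\<close> changes, and it gains the particle.
  The induction runs downward in \<open>i\<close> from the empty sums with
  \<open>i > M\<close>.\<close>

lemma height_plus_move:
  assumes "j < M" "\<xi> j = Suc n"
  shows "height_plus M k rho (\<xi>(j := n, Suc j := Suc (\<xi> (Suc j)))) i =
    height_plus M k rho \<xi> i + (if i = Suc j then 2 else 0)"
proof (induction "Suc M - i" arbitrary: i)
  case 0
  then show ?case using assms(1) by (simp add: height_plus_def)
next
  case (Suc d)
  then have "i \<le> M" "d = Suc M - Suc i" by auto
  with Suc.hyps(1)[of "Suc i"] show ?case
    using assms by (auto simp: height_plus_Suc)
qed

lemma height_plus_antimono:
  assumes "\<forall>j\<in>{1..M}. 0 < k j" "1 \<le> i" "i \<le> j" "j \<le> Suc M"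
  shows "height_plus M k rho \<xi> j \<le> height_plus M k rho \<xi> i"
  using assms(3,4)
proof (induction j rule: dec_induct)
  case (step n)
  then show ?case using bspec[OF assms(1), of n] assms(2) height_plus_Suc[of n M k rho \<xi>] by simp
qed simp

section \<open>State spaces and reversibility of the two processes\<close>

definition state_space :: "nat \<Rightarrow> (nat \<Rightarrow> real) \<Rightarrow> real \<Rightarrow> (nat \<Rightarrow> nat) set" where
  "state_space M k a = (if a > -1 then configs M else configs_below M k a)"

text \<open>For \<open>lam > -1\<close> no height falls below \<open>lam\<close>. Otherwise
  \<open>configs_below\<close> says that the last height is negative, and the heights increase up to
  it.\<close>

lemma admissible_height_minus:
  assumes k: "\<forall>j\<in>{1..M}. 0 < k j" and \<zeta>: "\<zeta> \<in> state_space M k lam" and j: "1 \<le> j" "j \<le> M"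
  shows "admissible lam (\<zeta> j) (height_minus k lam \<zeta> (j - 1)) (k j)"
proof (cases "lam > -1")
  case True
  moreover have "lam \<le> height_minus k lam \<zeta> (j - 1)"
    using height_minus_mono[OF k, of 0 "j - 1" lam \<zeta>] j by (simp add: height_minus_0)
  ultimately show ?thesis
    using k j by (simp add: admissible_def)
next
  case False
  have "height_minus k lam \<zeta> M < 0"
    using \<zeta> False
    by (simp add: state_space_def configs_below_def height_minus_def sum.distrib sum_distrib_left)
  then show ?thesis
    using height_minus_mono[OF k j(2) order_refl, of lam \<zeta>] height_minus_Suc[of k lam \<zeta> "j - 1"] k j False
    by (simp add: admissible_def)
qed

lemma admissible_height_plus:
  assumes k: "\<forall>j\<in>{1..M}. 0 < k j" and \<xi>: "\<xi> \<in> state_space M k rho" and j: "1 \<le> j" "j \<le> M"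
  shows "admissible rho (\<xi> j) (height_plus M k rho \<xi> (Suc j)) (k j)"
proof (cases "rho > -1")
  case True
  have "height_plus M k rho \<xi> (Suc M) = rho" by (simp add: height_plus_def)
  then show ?thesis
    using height_plus_antimono[OF k, of "Suc j" "Suc M" rho \<xi>] k j True by (simp add: admissible_def)
next
  case False
  \<comment> \<open>The height at site 1 is the full sum bounded in \<open>configs_below\<close>,
    and the largest height.\<close>
  have "height_plus M k rho \<xi> 1 < 0"
    using \<xi> False
    by (simp add: state_space_def configs_below_def height_plus_def sum.distrib sum_distrib_left)
  then show ?thesis
    using height_plus_antimono[OF k, of 1 j rho \<xi>] k j False height_plus_Suc[of j M k rho \<xi>]
    by (simp add: admissible_def)
qed

lemma reversible_ASIP_L:
  assumes q: "0 < q" "q < 1" and k: "\<forall>j\<in>{1..M}. 0 < k j"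
  shows "reversible (state_space M k lam) (W_L M k q lam) (ASIP_L M k q lam)"
  unfolding ASIP_L_def
proof (rule reversible_jump_rateI)
  fix \<zeta> assume "\<zeta> \<in> state_space M k lam"
  then show "0 \<le> W_L M k q lam \<zeta>"
    unfolding W_L_def
    by (intro prod_nonneg w_dyn_nonneg[OF q])
      (use admissible_height_minus[OF k] in auto)
next
  fix \<zeta> j n
  let ?\<zeta>' = "\<zeta>(j := n, Suc j := Suc (\<zeta> (Suc j)))"
  assume \<zeta>: "\<zeta> \<in> state_space M k lam" "?\<zeta>' \<in> state_space M k lam"
    and j: "1 \<le> j" "j < M" and n: "\<zeta> j = Suc n"
  let ?h = "height_minus k lam \<zeta>"
  note mv = height_minus_move[of j \<zeta>, OF j(1) n]
  \<comment> \<open>With this, \<open>mv\<close> leaves the height in front of site \<open>j\<close>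
    unchanged.\<close>
  have "j - 1 \<noteq> j" using j by simp
  have hj: "?h j = ?h (j - 1) + 2 * (real n + 1) + k j"
    using height_minus_Suc[of k lam \<zeta> "j - 1"] j n by simp
  have adm1: "admissible lam (Suc n) (?h (j - 1)) (k j)"
    using admissible_height_minus[OF k \<zeta>(1), of j] j n by simp
  \<comment> \<open>The height at \<open>j\<close> after the jump is \<open>?h j - 2\<close>, so
    this comes from membership of the target state.\<close>
  have adm2: "admissible lam (Suc (\<zeta> (Suc j))) (?h j - 2) (k (Suc j))"
    using admissible_height_minus[OF k \<zeta>(2), of "Suc j"] j by (simp add: mv)
  note bal = two_site_balance[OF q adm1 adm2[unfolded hj], folded hj]
  \<comment> \<open>Brings the last q-number into the form in which the left rate at
    \<open>Suc j\<close> contains it after the jump.\<close>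
  have "?h j + k (Suc j) + real (\<zeta> (Suc j)) - 1 = ?h (Suc j) - (real (\<zeta> (Suc j)) + 1)"
    by (simp add: height_minus_Suc)
  note bal' = bal[unfolded this]
  show "W_L M k q lam \<zeta> * rate_L_right k q lam \<zeta> j =
    W_L M k q lam ?\<zeta>' * rate_L_left k q lam ?\<zeta>' (Suc j)"
    unfolding W_L_def
  proof (rule prod_two_sites[OF j])
    show "w_dyn lam (\<zeta> j) (?h (j - 1)) (k j) q * w_dyn lam (\<zeta> (Suc j)) (?h (Suc j - 1)) (k (Suc j)) q *
      rate_L_right k q lam \<zeta> j =
      w_dyn lam (?\<zeta>' j) (height_minus k lam ?\<zeta>' (j - 1)) (k j) q *
      w_dyn lam (?\<zeta>' (Suc j)) (height_minus k lam ?\<zeta>' (Suc j - 1)) (k (Suc j)) q *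
      rate_L_left k q lam ?\<zeta>' (Suc j)"
      using bal' j n \<open>j - 1 \<noteq> j\<close> by (simp add: rate_L_right_def rate_L_left_def Let_def mv add.commute)
  qed (use j in \<open>auto simp: mv\<close>)
qed

text \<open>Now site \<open>Suc j\<close> determines the height between the two sites, and it holds
  the extra particle after the right jump. So the target state is on the left side of
  \<open>two_site_balance\<close>, which is read backwards.\<close>

lemma reversible_ASIP_R:
  assumes q: "0 < q" "q < 1" and k: "\<forall>j\<in>{1..M}. 0 < k j"
  shows "reversible (state_space M k rho) (W_R M k q rho) (ASIP_R M k q rho)"
  unfolding ASIP_R_def
proof (rule reversible_jump_rateI)
  fix \<xi> assume "\<xi> \<in> state_space M k rho"
  then show "0 \<le> W_R M k q rho \<xi>"
    unfolding W_R_def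
    by (intro prod_nonneg w_dyn_nonneg[OF q]) (use admissible_height_plus[OF k] in auto)
next
  fix \<xi> j n
  let ?\<xi>' = "\<xi>(j := n, Suc j := Suc (\<xi> (Suc j)))"
  assume \<xi>: "\<xi> \<in> state_space M k rho" "?\<xi>' \<in> state_space M k rho"
    and j: "1 \<le> j" "j < M" and n: "\<xi> j = Suc n"
  let ?h = "height_plus M k rho \<xi>"
  note mv = height_plus_move[of j M \<xi>, OF j(2) n]
  \<comment> \<open>The height between the sites after the jump, which is the \<open>h\<close> of
    the two-site identity.\<close>
  have hj: "?h (Suc j) + 2 = ?h (Suc (Suc j)) + 2 * (real (\<xi> (Suc j)) + 1) + k (Suc j)"
    using height_plus_Suc[of "Suc j" M k rho \<xi>] j by simp
  have adm1: "admissible rho (Suc (\<xi> (Suc j))) (?h (Suc (Suc j))) (k (Suc j))"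
    using admissible_height_plus[OF k \<xi>(2), of "Suc j"] j by (simp add: mv)
  \<comment> \<open>The unsimplified \<open>+ 2 - 2\<close>, here and in \<open>right\<close>,
    matches \<open>h - 2\<close> in that identity.\<close>
  have adm2: "admissible rho (Suc n) (?h (Suc j) + 2 - 2) (k j)"
    using admissible_height_plus[OF k \<xi>(1), of j] j n by simp
  note bal = two_site_balance[OF q adm1 adm2[unfolded hj], folded hj]
  have "?h (Suc j) + 2 + k j + real n - 1 = ?h j - (real n + 1)"
    using height_plus_Suc[of j M k rho \<xi>] j n by simp
  note bal' = bal[unfolded this]
  have left: "rate_R_left M k q rho ?\<xi>' (Suc j) =
      q_number q (real (\<xi> (Suc j)) + 1) * q_number q (real n + k j) *
      (q_number q (?h (Suc (Suc j)) + (real (\<xi> (Suc j)) + 1)) * q_number q (?h (Suc j) + 2 + real n) /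
        (q_number q (?h (Suc j) + 2) * q_number q (?h (Suc j) + 2 - 1)))"
    by (simp add: rate_R_left_def Let_def mv add.commute)
  have right: "rate_R_right M k q rho \<xi> j =
      q_number q (real n + 1) * q_number q (real (\<xi> (Suc j)) + k (Suc j)) *
      (if \<xi> (Suc j) = 0 then 1 else q_number q (?h (Suc j) + 2 - 2 - real (\<xi> (Suc j))) / q_number q (?h (Suc j) + 2 - 2)) *
      (q_number q (?h j - (real n + 1)) / q_number q (?h (Suc j) + 2 - 1))"
    by (simp add: rate_R_right_def Let_def n add.commute)
  show "W_R M k q rho \<xi> * rate_R_right M k q rho \<xi> j =
    W_R M k q rho ?\<xi>' * rate_R_left M k q rho ?\<xi>' (Suc j)"
    unfolding W_R_def
  proof (rule prod_two_sites[OF j])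
    have "w_dyn rho (\<xi> j) (?h (j + 1)) (k j) q * w_dyn rho (\<xi> (Suc j)) (?h (Suc j + 1)) (k (Suc j)) q *
        rate_R_right M k q rho \<xi> j =
      w_dyn rho (\<xi> (Suc j)) (?h (Suc (Suc j))) (k (Suc j)) q * w_dyn rho (Suc n) (?h (Suc j) + 2 - 2) (k j) q *
        rate_R_right M k q rho \<xi> j"
      by (simp add: n)
    also have "\<dots> = w_dyn rho (Suc (\<xi> (Suc j))) (?h (Suc (Suc j))) (k (Suc j)) q *
      w_dyn rho n (?h (Suc j) + 2) (k j) q * rate_R_left M k q rho ?\<xi>' (Suc j)"
      unfolding left right by (rule bal'[symmetric])
    also have "\<dots> = w_dyn rho (?\<xi>' j) (height_plus M k rho ?\<xi>' (j + 1)) (k j) q *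
      w_dyn rho (?\<xi>' (Suc j)) (height_plus M k rho ?\<xi>' (Suc j + 1)) (k (Suc j)) q *
      rate_R_left M k q rho ?\<xi>' (Suc j)"
      by (simp add: mv)
    finally show "w_dyn rho (\<xi> j) (?h (j + 1)) (k j) q * w_dyn rho (\<xi> (Suc j)) (?h (Suc j + 1)) (k (Suc j)) q *
        rate_R_right M k q rho \<xi> j =
      w_dyn rho (?\<xi>' j) (height_plus M k rho ?\<xi>' (j + 1)) (k j) q *
      w_dyn rho (?\<xi>' (Suc j)) (height_plus M k rho ?\<xi>' (Suc j + 1)) (k (Suc j)) q *
      rate_R_left M k q rho ?\<xi>' (Suc j)" .
  qed (use j in \<open>auto simp: mv\<close>)
qed

theorem theorem2p16:
  fixes q :: real and M :: nat and k :: "nat \<Rightarrow> real" and lam rho :: real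
  assumes "0 < q" and "q < 1"
    and "\<forall>j\<in>{1..M}. 0 < k j"
  shows "((lam > -1 \<longrightarrow> reversible (configs M) (W_L M k q lam) (ASIP_L M k q lam)) \<and>
      (lam \<le> -1 \<longrightarrow> reversible (configs_below M k lam) (W_L M k q lam) (ASIP_L M k q lam))) \<and>
    ((rho > -1 \<longrightarrow> reversible (configs M) (W_R M k q rho) (ASIP_R M k q rho)) \<and>
      (rho \<le> -1 \<longrightarrow> reversible (configs_below M k rho) (W_R M k q rho) (ASIP_R M k q rho)))"
  using reversible_ASIP_L[OF assms, of lam] reversible_ASIP_R[OF assms, of rho]
  by (auto simp: state_space_def)

end
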